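(* Let $X,Y\in\mathcal M$ with $X\neq\emptyset$, and let $\mathrm{app}:Y^X\times X\to Y$ be the function $\mathrm{app}(f,x)=f(x)$ of $\mathcal M$. Then $$I\Vdash\forall f^{\gimel(Y^X)}\forall g^{\gimel(Y^X)}\big(\forall x^{\gimel X}(\mathrm{app}(f,x)=\mathrm{app}(g,x))\to f=g\big);$$ in particular, in $\mathcal N_{\mathcal A}$, app gives an injection from $\gimel(Y^X)$ into $(\gimel Y)^{\gimel X}$.
   Context: Realizability algebra: sets $\Lambda$ (terms), $\Pi$ (stacks), $\Lambda\star\Pi$, application $(\xi)\eta$, push $\xi\cdot\pi$, process $\xi\star\pi$, continuations $k_\pi$, instructions $B,C,I,K,W,\mathrm{cc}$ with execution $\succ$ (least preorder with $(\xi)\eta\star\pi\succ\xi\star\eta\cdot\pi$, $I\star\xi\cdot\pi\succ\xi\star\pi$, $K\star\xi\cdot\eta\cdot\pi\succ\xi\star\pi$, $W\star\xi\cdot\eta\cdot\pi\succ\xi\star\eta\cdot\eta\cdot\pi$, $C\star\xi\cdot\eta\cdot\zeta\cdot\pi\succ\xi\star\zeta\cdot\eta\cdot\pi$, $B\star\xi\cdot\eta\cdot\zeta\cdot\pi\succ\xi\star(\eta)\zeta\cdot\pi$, $\mathrm{cc}\star\xi\cdot\pi\succ\xi\star k_\pi\cdot\pi$, $k_\pi\star\xi\cdot\varpi\succ\xi\star\pi$), a set $\perp\!\!\!\perp$ of processes closed under anti-execution, and proof-like terms QP (containing the instructions, closed under application; coherence: no $\theta\in$ QP has $\theta\star\pi\in\perp\!\!\!\perp$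 for all $\pi$). $\mathcal M\models$ ZF+$V=L$ is the ground model containing a coherent algebra $\mathcal A$. Formulas: from $\top,\bot,t\not\varepsilon u,t\notin u,t\subset u$ with $\to,\forall$; $\neg A:=A\to\bot$. Functionals of $\mathcal M$ are function symbols. In the realizability model $\mathcal N_{\mathcal A}$ (individuals of $\mathcal M$), $\|\top\|=\emptyset$, $\|\bot\|=\Pi$, $\|a\not\varepsilon b\|=\{\pi:(a,\pi)\in b\}$, $\|a\subset b\|=\bigcup_c\{\xi\cdot\pi:(c,\pi)\in a,\xi\Vdash c\notin b\}$, $\|a\notin b\|=\bigcup_c\{\xi\cdot\xi'\cdot\pi:(c,\pi)\in b,\xi\Vdash a\subset c,\xi'\Vdash c\subset a\}$, $\|A\to B\|=\{\xi\cdot\pi:\xi\Vdash A,\pi\in\|B\|\}$, $\|\forall xA\|=\bigcup_a\|A[a/x]\|$; $\xi\Vdash F$ iff $\xi\star\pi\in\perp\!\!\!\perp$ for all $\pi\in\|F\|$; $F$ is realized if some $\theta\in$QP realizes it. Equality $x=y$ is Leibniz equality $\forall z(x\not\varepsilon z\to y\not\varepsilon z)$. For $X\in\mathcal M$, $\gimel X=X\times\Pi$ and $\|\forall x^{\gimel X}F[x]\|=\bigcup_{a\in X}\|F[a]\|$. *)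

theory Defs
  imports Main
begin

section \<open>Models of ZF + V=L\<close>

text \<open>
  The ground model is a type \<open>'m\<close> of individuals with a binary relation \<open>E\<close>, where \<open>E x a\<close>
  is read ``\<open>x\<close> is an element of \<open>a\<close>''.  It need be neither transitive nor well founded, so every
  set-theoretic notion below is the one of the model: all its quantifiers range over \<open>'m\<close>.
\<close>

datatype fm = FMem nat nat | FEq nat nat | FNeg fm | FAnd fm fm | FAll nat fm

primrec sat :: "('m \<Rightarrow> 'm \<Rightarrow> bool) \<Rightarrow> (nat \<Rightarrow> 'm) \<Rightarrow> fm \<Rightarrow> bool" where
  "sat E s (FMem i j) \<longleftrightarrow> E (s i) (s j)"
| "sat E s (FEq i j) \<longleftrightarrow> s i = s j"
| "sat E s (FNeg p) \<longleftrightarrow> \<not> sat E s p"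
| "sat E s (FAnd p q) \<longleftrightarrow> sat E s p \<and> sat E s q"
| "sat E s (FAll i p) \<longleftrightarrow> (\<forall>x. sat E (s(i := x)) p)"

definition elts :: "('m \<Rightarrow> 'm \<Rightarrow> bool) \<Rightarrow> 'm \<Rightarrow> 'm set" where
  "elts E a = {x. E x a}"

text \<open>
  In Separation and Replacement the assignment \<open>s\<close> supplies the parameters.
\<close>

definition ZF :: "('m \<Rightarrow> 'm \<Rightarrow> bool) \<Rightarrow> bool" where
  "ZF E \<longleftrightarrow>
     (\<forall>a b. elts E a = elts E b \<longrightarrow> a = b) \<and>
     (\<forall>a. elts E a \<noteq> {} \<longrightarrow> (\<exists>x \<in> elts E a. elts E x \<inter> elts E a = {})) \<and>
     (\<forall>a b. \<exists>c. elts E c = {a, b}) \<and>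
     (\<forall>a. \<exists>u. elts E u = (\<Union>x \<in> elts E a. elts E x)) \<and>
     (\<forall>a. \<exists>p. elts E p = {x. elts E x \<subseteq> elts E a}) \<and>
     (\<exists>w. (\<exists>e. E e w \<and> elts E e = {}) \<and>
          (\<forall>x. E x w \<longrightarrow> (\<exists>y. E y w \<and> elts E y = insert x (elts E x)))) \<and>
     (\<forall>p s a. \<exists>b. elts E b = {x. E x a \<and> sat E (s(0 := x)) p}) \<and>
     (\<forall>p s a. (\<forall>x. E x a \<longrightarrow> (\<exists>!y. sat E (s(0 := x, 1 := y)) p)) \<longrightarrow>
        (\<exists>b. elts E b = {y. \<exists>x. E x a \<and> sat E (s(0 := x, 1 := y)) p}))"

text \<open>
  \<open>the_set E S\<close> is the individual whose elements are those of \<open>S\<close>; it is only meaningful when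
  such an individual exists.
\<close>

definition the_set :: "('m \<Rightarrow> 'm \<Rightarrow> bool) \<Rightarrow> 'm set \<Rightarrow> 'm" where
  "the_set E S = (THE a. elts E a = S)"

definition upair :: "('m \<Rightarrow> 'm \<Rightarrow> bool) \<Rightarrow> 'm \<Rightarrow> 'm \<Rightarrow> 'm" where
  "upair E a b = the_set E {a, b}"

definition opair :: "('m \<Rightarrow> 'm \<Rightarrow> bool) \<Rightarrow> 'm \<Rightarrow> 'm \<Rightarrow> 'm" where
  "opair E a b = upair E (upair E a a) (upair E a b)"

definition cart :: "('m \<Rightarrow> 'm \<Rightarrow> bool) \<Rightarrow> 'm \<Rightarrow> 'm \<Rightarrow> 'm" where
  "cart E a b = the_set E {opair E x y | x y. E x a \<and> E y b}"

definition is_fun :: "('m \<Rightarrow> 'm \<Rightarrow> bool) \<Rightarrow> 'm \<Rightarrow> 'm \<Rightarrow> 'm \<Rightarrow> bool" where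
  "is_fun E f a b \<longleftrightarrow>
     (\<forall>z. E z f \<longrightarrow> (\<exists>x y. E x a \<and> E y b \<and> z = opair E x y)) \<and>
     (\<forall>x. E x a \<longrightarrow> (\<exists>!y. E (opair E x y) f))"

definition fun_space :: "('m \<Rightarrow> 'm \<Rightarrow> bool) \<Rightarrow> 'm \<Rightarrow> 'm \<Rightarrow> 'm" where
  "fun_space E a b = the_set E {f. is_fun E f a b}"

definition fapply :: "('m \<Rightarrow> 'm \<Rightarrow> bool) \<Rightarrow> 'm \<Rightarrow> 'm \<Rightarrow> 'm" where
  "fapply E f x = (THE y. E (opair E x y) f)"

definition is_ord :: "('m \<Rightarrow> 'm \<Rightarrow> bool) \<Rightarrow> 'm \<Rightarrow> bool" where
  "is_ord E a \<longleftrightarrow>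
     (\<forall>x. E x a \<longrightarrow> elts E x \<subseteq> elts E a \<and> (\<forall>y. E y x \<longrightarrow> elts E y \<subseteq> elts E x))"

definition is_nat :: "('m \<Rightarrow> 'm \<Rightarrow> bool) \<Rightarrow> 'm \<Rightarrow> bool" where
  "is_nat E n \<longleftrightarrow> is_ord E n \<and>
     (\<forall>m. m = n \<or> E m n \<longrightarrow> elts E m = {} \<or> (\<exists>k. elts E m = insert k (elts E k)))"

definition suc :: "('m \<Rightarrow> 'm \<Rightarrow> bool) \<Rightarrow> 'm \<Rightarrow> 'm" where
  "suc E n = the_set E (insert n (elts E n))"

text \<open>
  Definability over a set \<open>A\<close> inside the model, without coding of formulas (as in Kunen's
  \<^emph>\<open>Set Theory\<close>, Ch. VI): the definable \<open>n\<close>-ary relations are the smallest family containing the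
  relations given by \<open>s(i) \<in> s(j)\<close> and \<open>s(i) = s(j)\<close> and closed under complement, intersection
  and projection.  A family \<open>D\<close> is a set of pairs \<open>(n, R)\<close> with \<open>R\<close> a set of \<open>n\<close>-tuples, and an
  \<open>n\<close>-tuple is a function from \<open>n\<close> to \<open>A\<close>.
\<close>

definition def_closed :: "('m \<Rightarrow> 'm \<Rightarrow> bool) \<Rightarrow> 'm \<Rightarrow> 'm \<Rightarrow> bool" where
  "def_closed E A D \<longleftrightarrow> (\<forall>n. is_nat E n \<longrightarrow>
     (\<forall>i j. E i n \<and> E j n \<longrightarrow>
        E (opair E n (the_set E {s. is_fun E s n A \<and> E (fapply E s i) (fapply E s j)})) D \<and>
        E (opair E n (the_set E {s. is_fun E s n A \<and> fapply E s i = fapply E s j})) D) \<and>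
     (\<forall>R. E (opair E n R) D \<longrightarrow>
        E (opair E n (the_set E {s. is_fun E s n A \<and> \<not> E s R})) D) \<and>
     (\<forall>R S. E (opair E n R) D \<and> E (opair E n S) D \<longrightarrow>
        E (opair E n (the_set E (elts E R \<inter> elts E S))) D) \<and>
     (\<forall>R. E (opair E (suc E n) R) D \<longrightarrow>
        E (opair E n (the_set E {s. is_fun E s n A \<and>
            (\<exists>t. E t R \<and> (\<forall>i. E i n \<longrightarrow> fapply E t i = fapply E s i))})) D))"

definition definable_rel :: "('m \<Rightarrow> 'm \<Rightarrow> bool) \<Rightarrow> 'm \<Rightarrow> 'm \<Rightarrow> 'm \<Rightarrow> bool" where
  "definable_rel E A n R \<longleftrightarrow> (\<forall>D. def_closed E A D \<longrightarrow> E (opair E n R) D)"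

definition Def :: "('m \<Rightarrow> 'm \<Rightarrow> bool) \<Rightarrow> 'm \<Rightarrow> 'm" where
  "Def E A = the_set E {Z. \<exists>n s R. is_nat E n \<and> is_fun E s n A \<and> definable_rel E A (suc E n) R \<and>
     elts E Z = {x. E x A \<and> (\<exists>t. E t R \<and> (\<forall>i. E i n \<longrightarrow> fapply E t i = fapply E s i) \<and>
                              fapply E t n = x)}}"

text \<open>
  The function \<open>f\<close> below is the initial segment of the constructible hierarchy of length \<open>\<alpha>\<close>,
  via the uniform recursion \<open>L\<^sub>\<gamma> = (\<Union>\<delta><\<gamma>. Def L\<^sub>\<delta>)\<close>.
\<close>

definition constructible :: "('m \<Rightarrow> 'm \<Rightarrow> bool) \<Rightarrow> 'm \<Rightarrow> bool" where
  "constructible E x \<longleftrightarrow> (\<exists>\<alpha> f b \<beta>. is_ord E \<alpha> \<and> is_fun E f \<alpha> b \<and>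
     (\<forall>\<gamma>. E \<gamma> \<alpha> \<longrightarrow>
        elts E (fapply E f \<gamma>) = (\<Union>\<delta> \<in> elts E \<gamma>. elts E (Def E (fapply E f \<delta>)))) \<and>
     E \<beta> \<alpha> \<and> E x (fapply E f \<beta>))"

definition ZF_VL :: "('m \<Rightarrow> 'm \<Rightarrow> bool) \<Rightarrow> bool" where
  "ZF_VL E \<longleftrightarrow> ZF E \<and> (\<forall>x. constructible E x)"

text \<open>
  A \<open>k\<close>-ary functional of the model is an everywhere defined operation that is first-order
  definable with parameters: the value is variable \<open>0\<close>, the arguments are variables \<open>1, \<dots>, k\<close>,
  and \<open>s\<close> interprets the remaining variables.
\<close>

definition functional :: "('m \<Rightarrow> 'm \<Rightarrow> bool) \<Rightarrow> nat \<Rightarrow> ('m list \<Rightarrow> 'm) \<Rightarrow> bool" where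
  "functional E k F \<longleftrightarrow> (\<exists>p s. \<forall>xs y. length xs = k \<longrightarrow>
     (sat E (\<lambda>i. if i \<le> k then (y # xs) ! i else s i) p \<longleftrightarrow> y = F xs))"


section \<open>Realizability algebras\<close>

text \<open>All components, including the operations, are individuals of the ground model.\<close>

record 'm ralg =
  Lam :: 'm
  Stk :: 'm
  Prc :: 'm
  app_op :: 'm
  push_op :: 'm
  proc_op :: 'm
  cont_op :: 'm
  iB :: 'm
  iC :: 'm
  iI :: 'm
  iK :: 'm
  iW :: 'm
  icc :: 'm
  Pole :: 'm
  QP :: 'm

definition ap :: "('m \<Rightarrow> 'm \<Rightarrow> bool) \<Rightarrow> 'm ralg \<Rightarrow> 'm \<Rightarrow> 'm \<Rightarrow> 'm" where
  "ap E A \<xi> \<eta> = fapply E (app_op A) (opair E \<xi> \<eta>)"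

definition push :: "('m \<Rightarrow> 'm \<Rightarrow> bool) \<Rightarrow> 'm ralg \<Rightarrow> 'm \<Rightarrow> 'm \<Rightarrow> 'm" where
  "push E A \<xi> \<pi> = fapply E (push_op A) (opair E \<xi> \<pi>)"

definition proc :: "('m \<Rightarrow> 'm \<Rightarrow> bool) \<Rightarrow> 'm ralg \<Rightarrow> 'm \<Rightarrow> 'm \<Rightarrow> 'm" where
  "proc E A \<xi> \<pi> = fapply E (proc_op A) (opair E \<xi> \<pi>)"

definition cont :: "('m \<Rightarrow> 'm \<Rightarrow> bool) \<Rightarrow> 'm ralg \<Rightarrow> 'm \<Rightarrow> 'm" where
  "cont E A \<pi> = fapply E (cont_op A) \<pi>"

inductive step :: "('m \<Rightarrow> 'm \<Rightarrow> bool) \<Rightarrow> 'm ralg \<Rightarrow> 'm \<Rightarrow> 'm \<Rightarrow> bool" for E A where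
  "\<lbrakk>E \<xi> (Lam A); E \<eta> (Lam A); E \<pi> (Stk A)\<rbrakk> \<Longrightarrow>
     step E A (proc E A (ap E A \<xi> \<eta>) \<pi>) (proc E A \<xi> (push E A \<eta> \<pi>))"
| "\<lbrakk>E \<xi> (Lam A); E \<pi> (Stk A)\<rbrakk> \<Longrightarrow>
     step E A (proc E A (iI A) (push E A \<xi> \<pi>)) (proc E A \<xi> \<pi>)"
| "\<lbrakk>E \<xi> (Lam A); E \<eta> (Lam A); E \<pi> (Stk A)\<rbrakk> \<Longrightarrow>
     step E A (proc E A (iK A) (push E A \<xi> (push E A \<eta> \<pi>))) (proc E A \<xi> \<pi>)"
| "\<lbrakk>E \<xi> (Lam A); E \<eta> (Lam A); E \<pi> (Stk A)\<rbrakk> \<Longrightarrow>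
     step E A (proc E A (iW A) (push E A \<xi> (push E A \<eta> \<pi>)))
              (proc E A \<xi> (push E A \<eta> (push E A \<eta> \<pi>)))"
| "\<lbrakk>E \<xi> (Lam A); E \<eta> (Lam A); E \<zeta> (Lam A); E \<pi> (Stk A)\<rbrakk> \<Longrightarrow>
     step E A (proc E A (iC A) (push E A \<xi> (push E A \<eta> (push E A \<zeta> \<pi>))))
              (proc E A \<xi> (push E A \<zeta> (push E A \<eta> \<pi>)))"
| "\<lbrakk>E \<xi> (Lam A); E \<eta> (Lam A); E \<zeta> (Lam A); E \<pi> (Stk A)\<rbrakk> \<Longrightarrow>
     step E A (proc E A (iB A) (push E A \<xi> (push E A \<eta> (push E A \<zeta> \<pi>))))
              (proc E A \<xi> (push E A (ap E A \<eta> \<zeta>) \<pi>))"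
| "\<lbrakk>E \<xi> (Lam A); E \<pi> (Stk A)\<rbrakk> \<Longrightarrow>
     step E A (proc E A (icc A) (push E A \<xi> \<pi>)) (proc E A \<xi> (push E A (cont E A \<pi>) \<pi>))"
| "\<lbrakk>E \<xi> (Lam A); E \<pi> (Stk A); E \<rho> (Stk A)\<rbrakk> \<Longrightarrow>
     step E A (proc E A (cont E A \<pi>) (push E A \<xi> \<rho>)) (proc E A \<xi> \<pi>)"

text \<open>The least preorder containing \<open>step\<close> in the sense of the model: \<open>R\<close> is an individual.\<close>

definition exec :: "('m \<Rightarrow> 'm \<Rightarrow> bool) \<Rightarrow> 'm ralg \<Rightarrow> 'm \<Rightarrow> 'm \<Rightarrow> bool" where
  "exec E A p q \<longleftrightarrow> E p (Prc A) \<and> E q (Prc A) \<and>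
     (\<forall>R. (\<forall>u. E u (Prc A) \<longrightarrow> E (opair E u u) R) \<and>
          (\<forall>u v w. E (opair E u v) R \<and> E (opair E v w) R \<longrightarrow> E (opair E u w) R) \<and>
          (\<forall>u v. step E A u v \<longrightarrow> E (opair E u v) R) \<longrightarrow> E (opair E p q) R)"

definition realizability_algebra :: "('m \<Rightarrow> 'm \<Rightarrow> bool) \<Rightarrow> 'm ralg \<Rightarrow> bool" where
  "realizability_algebra E A \<longleftrightarrow>
     is_fun E (app_op A) (cart E (Lam A) (Lam A)) (Lam A) \<and>
     is_fun E (push_op A) (cart E (Lam A) (Stk A)) (Stk A) \<and>
     is_fun E (proc_op A) (cart E (Lam A) (Stk A)) (Prc A) \<and>
     is_fun E (cont_op A) (Stk A) (Lam A) \<and>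
     elts E (Pole A) \<subseteq> elts E (Prc A) \<and>
     (\<forall>p q. exec E A p q \<and> E q (Pole A) \<longrightarrow> E p (Pole A)) \<and>
     elts E (QP A) \<subseteq> elts E (Lam A) \<and>
     {iB A, iC A, iI A, iK A, iW A, icc A} \<subseteq> elts E (QP A) \<and>
     (\<forall>\<xi> \<eta>. E \<xi> (QP A) \<and> E \<eta> (QP A) \<longrightarrow> E (ap E A \<xi> \<eta>) (QP A))"

definition coherent :: "('m \<Rightarrow> 'm \<Rightarrow> bool) \<Rightarrow> 'm ralg \<Rightarrow> bool" where
  "coherent E A \<longleftrightarrow>
     \<not> (\<exists>\<theta>. E \<theta> (QP A) \<and> (\<forall>\<pi>. E \<pi> (Stk A) \<longrightarrow> E (proc E A \<theta> \<pi>) (Pole A)))"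

definition gimel :: "('m \<Rightarrow> 'm \<Rightarrow> bool) \<Rightarrow> 'm ralg \<Rightarrow> 'm \<Rightarrow> 'm" where
  "gimel E A X = cart E X (Stk A)"


section \<open>Formulas and realizability\<close>

datatype 'm trm = Var nat | Cst 'm | Fn "'m list \<Rightarrow> 'm" "'m trm list"

text \<open>
  \<open>NotEps\<close>, \<open>NotIn\<close> and \<open>Subs\<close> are the three atomic relations (negated strong membership, negated
  extensional membership, inclusion).  \<open>ForallG X n F\<close> is the quantifier restricted to the gimel
  of \<open>X\<close>.  The symbol of \<open>Fn\<close> is meant to be a functional of the ground model.
\<close>

datatype 'm frm =
    FTop
  | FBot
  | NotEps "'m trm" "'m trm"
  | NotIn "'m trm" "'m trm"
  | Subs "'m trm" "'m trm"
  | Imp "'m frm" "'m frm"  (infixr \<open>\<^bold>\<rightarrow>\<close> 55)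
  | Forall nat "'m frm"
  | ForallG 'm nat "'m frm"

primrec eval :: "(nat \<Rightarrow> 'm) \<Rightarrow> 'm trm \<Rightarrow> 'm" where
  "eval s (Var n) = s n"
| "eval s (Cst a) = a"
| "eval s (Fn F ts) = F (map (eval s) ts)"

primrec tvars :: "'m trm \<Rightarrow> nat set" where
  "tvars (Var n) = {n}"
| "tvars (Cst a) = {}"
| "tvars (Fn F ts) = \<Union> (set (map tvars ts))"

definition orth :: "('m \<Rightarrow> 'm \<Rightarrow> bool) \<Rightarrow> 'm ralg \<Rightarrow> 'm set \<Rightarrow> 'm set" where
  "orth E A P = {\<xi>. E \<xi> (Lam A) \<and> (\<forall>\<pi> \<in> P. E (proc E A \<xi> \<pi>) (Pole A))}"

text \<open>
  The truth values of \<open>a \<notin> b\<close> and \<open>a \<subset> b\<close> are defined in the model by simultaneous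
  well-founded recursion.  Since the model may be ill-founded from outside, the recursion is
  expressed by partial tables that are individuals: \<open>T\<close> is a transitive set, and \<open>N\<close>, \<open>S\<close> are sets
  of triples \<open>((a,b),\<rho>)\<close> satisfying the recursion clauses on \<open>T\<close>.  If \<open>(c,\<pi>)\<close> belongs to a
  member of \<open>T\<close>, then \<open>c\<close> belongs to \<open>T\<close>, by transitivity.
\<close>

definition row :: "('m \<Rightarrow> 'm \<Rightarrow> bool) \<Rightarrow> 'm \<Rightarrow> 'm \<Rightarrow> 'm \<Rightarrow> 'm set" where
  "row E N a b = {\<rho>. E (opair E (opair E a b) \<rho>) N}"

definition table :: "('m \<Rightarrow> 'm \<Rightarrow> bool) \<Rightarrow> 'm ralg \<Rightarrow> 'm \<Rightarrow> 'm \<Rightarrow> 'm \<Rightarrow> bool" where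
  "table E A T N S \<longleftrightarrow>
     (\<forall>x. E x T \<longrightarrow> elts E x \<subseteq> elts E T) \<and>
     (\<forall>a b. E a T \<and> E b T \<longrightarrow>
        row E S a b = {push E A \<xi> \<pi> | c \<xi> \<pi>.
          E \<pi> (Stk A) \<and> E (opair E c \<pi>) a \<and> \<xi> \<in> orth E A (row E N c b)} \<and>
        row E N a b = {push E A \<xi> (push E A \<xi>' \<pi>) | c \<xi> \<xi>' \<pi>.
          E \<pi> (Stk A) \<and> E (opair E c \<pi>) b \<and>
          \<xi> \<in> orth E A (row E S a c) \<and> \<xi>' \<in> orth E A (row E S c a)})"

definition notin_val :: "('m \<Rightarrow> 'm \<Rightarrow> bool) \<Rightarrow> 'm ralg \<Rightarrow> 'm \<Rightarrow> 'm \<Rightarrow> 'm set" where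
  "notin_val E A a b = {\<rho>. \<exists>T N S. table E A T N S \<and> E a T \<and> E b T \<and> \<rho> \<in> row E N a b}"

definition subs_val :: "('m \<Rightarrow> 'm \<Rightarrow> bool) \<Rightarrow> 'm ralg \<Rightarrow> 'm \<Rightarrow> 'm \<Rightarrow> 'm set" where
  "subs_val E A a b = {\<rho>. \<exists>T N S. table E A T N S \<and> E a T \<and> E b T \<and> \<rho> \<in> row E S a b}"

primrec falsity ::
  "('m \<Rightarrow> 'm \<Rightarrow> bool) \<Rightarrow> 'm ralg \<Rightarrow> (nat \<Rightarrow> 'm) \<Rightarrow> 'm frm \<Rightarrow> 'm set" where
  "falsity E A s FTop = {}"
| "falsity E A s FBot = elts E (Stk A)"
| "falsity E A s (NotEps t u) = {\<pi>. E \<pi> (Stk A) \<and> E (opair E (eval s t) \<pi>) (eval s u)}"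
| "falsity E A s (NotIn t u) = notin_val E A (eval s t) (eval s u)"
| "falsity E A s (Subs t u) = subs_val E A (eval s t) (eval s u)"
| "falsity E A s (F \<^bold>\<rightarrow> G) =
     {push E A \<xi> \<pi> | \<xi> \<pi>. \<xi> \<in> orth E A (falsity E A s F) \<and> \<pi> \<in> falsity E A s G}"
| "falsity E A s (Forall n F) = (\<Union>a. falsity E A (s(n := a)) F)"
| "falsity E A s (ForallG X n F) = (\<Union>a \<in> elts E X. falsity E A (s(n := a)) F)"

text \<open>For the closed formulas considered here the assignment \<open>s\<close> is irrelevant.\<close>

definition realizes :: "('m \<Rightarrow> 'm \<Rightarrow> bool) \<Rightarrow> 'm ralg \<Rightarrow> 'm \<Rightarrow> 'm frm \<Rightarrow> bool" where
  "realizes E A \<xi> F \<longleftrightarrow> (\<forall>s. \<xi> \<in> orth E A (falsity E A s F))"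

definition realized :: "('m \<Rightarrow> 'm \<Rightarrow> bool) \<Rightarrow> 'm ralg \<Rightarrow> 'm frm \<Rightarrow> bool" where
  "realized E A F \<longleftrightarrow> (\<exists>\<theta>. E \<theta> (QP A) \<and> realizes E A \<theta> F)"

abbreviation Not_f :: "'m frm \<Rightarrow> 'm frm" where
  "Not_f F \<equiv> F \<^bold>\<rightarrow> FBot"

abbreviation Conj_f :: "'m frm \<Rightarrow> 'm frm \<Rightarrow> 'm frm"  (infixr \<open>\<^bold>\<and>\<close> 60) where
  "F \<^bold>\<and> G \<equiv> Not_f (F \<^bold>\<rightarrow> G \<^bold>\<rightarrow> FBot)"

abbreviation Ex_f :: "nat \<Rightarrow> 'm frm \<Rightarrow> 'm frm" where
  "Ex_f n F \<equiv> Not_f (Forall n (Not_f F))"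

abbreviation Eps :: "'m trm \<Rightarrow> 'm trm \<Rightarrow> 'm frm"  (infix \<open>\<^bold>\<in>\<close> 70) where
  "t \<^bold>\<in> u \<equiv> Not_f (NotEps t u)"

definition Leibniz :: "'m trm \<Rightarrow> 'm trm \<Rightarrow> 'm frm"  (infix \<open>\<^bold>=\<close> 70) where
  "t \<^bold>= u = (let z = (LEAST z. z \<notin> tvars t \<union> tvars u)
            in Forall z (NotEps t (Var z) \<^bold>\<rightarrow> NotEps u (Var z)))"

definition Pair_t :: "('m \<Rightarrow> 'm \<Rightarrow> bool) \<Rightarrow> 'm trm \<Rightarrow> 'm trm \<Rightarrow> 'm trm" where
  "Pair_t E t u = Fn (\<lambda>xs. opair E (xs ! 0) (xs ! 1)) [t, u]"

text \<open>
  The variable \<open>g\<close> denotes the graph of a function from \<open>a\<close> to \<open>b\<close> in the realizability model.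
  Ordered pairs there are given by the pairing functional of the ground model.
\<close>

definition function_frm :: "('m \<Rightarrow> 'm \<Rightarrow> bool) \<Rightarrow> nat \<Rightarrow> 'm \<Rightarrow> 'm \<Rightarrow> 'm frm" where
  "function_frm E g a b = (let z = g + 1; x = g + 2; y = g + 3; y' = g + 4 in
     Forall z (Var z \<^bold>\<in> Var g \<^bold>\<rightarrow>
       Ex_f x (Ex_f y (Var x \<^bold>\<in> Cst a \<^bold>\<and> Var y \<^bold>\<in> Cst b \<^bold>\<and> Var z \<^bold>= Pair_t E (Var x) (Var y)))) \<^bold>\<and>
     Forall x (Var x \<^bold>\<in> Cst a \<^bold>\<rightarrow> Ex_f y (Pair_t E (Var x) (Var y) \<^bold>\<in> Var g)) \<^bold>\<and>
     Forall x (Forall y (Forall y'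
       (Pair_t E (Var x) (Var y) \<^bold>\<in> Var g \<^bold>\<rightarrow> Pair_t E (Var x) (Var y') \<^bold>\<in> Var g \<^bold>\<rightarrow>
        Var y \<^bold>= Var y'))))"

text \<open>
  In the realizability model, there is an injection \<open>j\<close> from (the set) \<open>a\<close> into the functions from
  \<open>b\<close> to \<open>c\<close> that sends \<open>f\<close> to the map sending \<open>x\<close> to \<open>ev(f,x)\<close>.  Two graphs count as the same
  function as soon as they have the same elements (for strong membership), which is weaker than
  Leibniz equality of the graphs; so the injectivity clause is the strong one.
\<close>

definition injection_frm ::
  "('m \<Rightarrow> 'm \<Rightarrow> bool) \<Rightarrow> ('m list \<Rightarrow> 'm) \<Rightarrow> 'm \<Rightarrow> 'm \<Rightarrow> 'm \<Rightarrow> 'm frm" where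
  "injection_frm E ev a b c = (let j = 0; f = 1; f' = 2; x = 3; z = 4; g = 5; g' = 6 in
     Ex_f j (
       Forall z (Var z \<^bold>\<in> Var j \<^bold>\<rightarrow>
         Ex_f f (Ex_f g (Var f \<^bold>\<in> Cst a \<^bold>\<and> function_frm E g b c \<^bold>\<and>
           Var z \<^bold>= Pair_t E (Var f) (Var g)))) \<^bold>\<and>
       Forall f (Var f \<^bold>\<in> Cst a \<^bold>\<rightarrow> Ex_f g (Pair_t E (Var f) (Var g) \<^bold>\<in> Var j)) \<^bold>\<and>
       Forall f (Forall g (Forall g'
         (Pair_t E (Var f) (Var g) \<^bold>\<in> Var j \<^bold>\<rightarrow> Pair_t E (Var f) (Var g') \<^bold>\<in> Var j \<^bold>\<rightarrow>
          Var g \<^bold>= Var g'))) \<^bold>\<and>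
       Forall f (Forall f' (Forall g (Forall g'
         (Pair_t E (Var f) (Var g) \<^bold>\<in> Var j \<^bold>\<rightarrow> Pair_t E (Var f') (Var g') \<^bold>\<in> Var j \<^bold>\<rightarrow>
          Forall z (Var z \<^bold>\<in> Var g \<^bold>\<rightarrow> Var z \<^bold>\<in> Var g') \<^bold>\<rightarrow>
          Forall z (Var z \<^bold>\<in> Var g' \<^bold>\<rightarrow> Var z \<^bold>\<in> Var g) \<^bold>\<rightarrow>
          Var f \<^bold>= Var f')))) \<^bold>\<and>
       Forall f (Forall g (Pair_t E (Var f) (Var g) \<^bold>\<in> Var j \<^bold>\<rightarrow>
         Forall x (Var x \<^bold>\<in> Cst b \<^bold>\<rightarrow>
           Pair_t E (Var x) (Fn ev [Var f, Var x]) \<^bold>\<in> Var g)))))"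

end

theory Submission
  imports Defs
begin

text \<open>
  The truth value of the Leibniz equality \<open>a = b\<close> is the largest possible one,
  \<open>\<parallel>\<top> \<rightarrow> \<bottom>\<parallel>\<close>, if \<open>a \<noteq> b\<close>, and \<open>{\<xi> \<cdot> \<pi>. \<xi> \<star> \<pi> \<in> \<bottom>\<bottom>}\<close> if \<open>a = b\<close>.  Two functions that differ
  already differ at some \<open>x \<in> X\<close>, and \<open>X\<close> is not empty, so \<open>\<parallel>app(f,x) = app(g,x)\<parallel>\<close> equals
  \<open>\<parallel>f = g\<parallel>\<close> for a suitable \<open>x\<close>; hence \<open>I\<close> realizes extensionality.

  For the injection, let \<open>j\<close> be the gimel of \<open>{(f, gimel f). f \<in> Y\<^sup>X}\<close>.  Since membership in a gimel
  is decided by the ground model, each clause reduces to a fact about ground model functions.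
\<close>

section \<open>Set theory in the ground model\<close>

definition FEx :: "nat \<Rightarrow> fm \<Rightarrow> fm" where
  "FEx i p = FNeg (FAll i (FNeg p))"

definition FOr :: "fm \<Rightarrow> fm \<Rightarrow> fm" where
  "FOr p q = FNeg (FAnd (FNeg p) (FNeg q))"

definition FIff :: "fm \<Rightarrow> fm \<Rightarrow> fm" where
  "FIff p q = FOr (FAnd p q) (FAnd (FNeg p) (FNeg q))"

lemma sat_connectives [simp]:
  "sat E s (FEx i p) \<longleftrightarrow> (\<exists>x. sat E (s(i := x)) p)"
  "sat E s (FOr p q) \<longleftrightarrow> sat E s p \<or> sat E s q"
  "sat E s (FIff p q) \<longleftrightarrow> (sat E s p \<longleftrightarrow> sat E s q)"
  by (auto simp: FEx_def FOr_def FIff_def)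

text \<open>Separation and Replacement are schemes over \<open>fm\<close>, so the notions they are
  applied to must be written as formulas. The bound variable exceeds all three arguments and is
  therefore fresh.\<close>

definition fm_upair :: "nat \<Rightarrow> nat \<Rightarrow> nat \<Rightarrow> fm" where
  "fm_upair w x y = (let z = Suc (w + x + y) in
     FAll z (FIff (FMem z w) (FOr (FEq z x) (FEq z y))))"

definition fm_opair :: "nat \<Rightarrow> nat \<Rightarrow> nat \<Rightarrow> fm" where
  "fm_opair w x y = (let u = Suc (w + x + y); v = Suc u in
     FEx u (FEx v (FAnd (fm_upair u x x) (FAnd (fm_upair v x y) (fm_upair w u v)))))"

definition fm_cart :: "nat \<Rightarrow> nat \<Rightarrow> nat \<Rightarrow> fm" where
  "fm_cart c a b = (let z = Suc (c + a + b); x = Suc z; y = Suc x in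
     FAll z (FIff (FMem z c)
       (FEx x (FEx y (FAnd (FMem x a) (FAnd (FMem y b) (fm_opair z x y)))))))"

section \<open>Consequences of the axioms of ZF\<close>

locale zf_model =
  fixes E :: "'m \<Rightarrow> 'm \<Rightarrow> bool"
  assumes ZF: "ZF E"
begin

lemmas ZF_conj = ZF[unfolded ZF_def]

lemma extensional: "elts E a = elts E b \<Longrightarrow> a = b"
  using ZF_conj[THEN conjunct1] by blast

lemma pairing: "\<exists>c. elts E c = {a, b}"
  using ZF_conj[THEN conjunct2, THEN conjunct2, THEN conjunct1] by blast

lemma union: "\<exists>u. elts E u = (\<Union>x \<in> elts E a. elts E x)"
  using ZF_conj[THEN conjunct2, THEN conjunct2, THEN conjunct2, THEN conjunct1] by blast

lemma power_set: "\<exists>p. elts E p = {x. elts E x \<subseteq> elts E a}"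
  using ZF_conj[THEN conjunct2, THEN conjunct2, THEN conjunct2, THEN conjunct2, THEN conjunct1]
  by blast

lemma elts_the_set: "\<exists>a. elts E a = S \<Longrightarrow> elts E (the_set E S) = S"
  unfolding the_set_def by (rule theI') (auto intro: extensional)

lemma elts_upair [simp]: "elts E (upair E a b) = {a, b}"
  unfolding upair_def by (rule elts_the_set) (rule pairing)

lemma mem_upair: "E z (upair E a b) \<longleftrightarrow> z = a \<or> z = b"
proof -
  have "E z (upair E a b) \<longleftrightarrow> z \<in> elts E (upair E a b)"
    by (simp only: elts_def mem_Collect_eq)
  then show ?thesis
    by simp
qed

lemma opair_inject [simp]: "opair E a b = opair E c d \<longleftrightarrow> a = c \<and> b = d"
proof
  assume "opair E a b = opair E c d"
  then have *: "{upair E a a, upair E a b} = {upair E c c, upair E c d}"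
    unfolding opair_def by (metis elts_upair)
  have inj: "upair E x y = upair E u v \<longleftrightarrow> {x, y} = {u, v}" for x y u v
    by (metis elts_upair extensional)
  show "a = c \<and> b = d"
    using * by (auto simp: doubleton_eq_iff inj)
qed simp

lemma sat_upair [simp]: "sat E s (fm_upair w x y) \<longleftrightarrow> s w = upair E (s x) (s y)"
proof -
  have "s w = upair E (s x) (s y) \<longleftrightarrow> elts E (s w) = {s x, s y}"
    by (metis elts_upair extensional)
  then show ?thesis
    by (auto simp: fm_upair_def Let_def elts_def)
qed

lemma sat_opair [simp]: "sat E s (fm_opair w x y) \<longleftrightarrow> s w = opair E (s x) (s y)"
  by (simp add: fm_opair_def Let_def opair_def)

lemma separation: "\<exists>b. elts E b = {x. E x a \<and> sat E (s(0 := x)) p}"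
  using ZF_conj[THEN conjunct2, THEN conjunct2, THEN conjunct2, THEN conjunct2, THEN conjunct2,
      THEN conjunct2, THEN conjunct1]
  by blast

text \<open>Makes the scheme usable for a HOL function \<open>F\<close> with a definable graph:
  variable 0 is the argument, variable 1 the value, and the others carry parameters.\<close>

lemma replacement:
  assumes "\<And>x y. E x a \<Longrightarrow> sat E (s(0 := x, 1 := y)) p \<longleftrightarrow> y = F x"
  shows "\<exists>b. elts E b = F ` elts E a"
proof -
  have "\<forall>x. E x a \<longrightarrow> (\<exists>!y. sat E (s(0 := x, 1 := y)) p)"
    using assms by simp
  then obtain b where "elts E b = {y. \<exists>x. E x a \<and> sat E (s(0 := x, 1 := y)) p}"
    using ZF_conj[THEN conjunct2, THEN conjunct2, THEN conjunct2, THEN conjunct2, THEN conjunct2,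
        THEN conjunct2, THEN conjunct2, THEN spec, THEN spec, THEN spec, THEN mp, of a s p]
    by blast
  then have "elts E b = F ` elts E a"
    using assms by (auto simp: elts_def)
  then show ?thesis ..
qed

section \<open>Products and function spaces\<close>

lemma elts_cart: "elts E (cart E a b) = {opair E x y | x y. E x a \<and> E y b}"
proof -
  \<comment> \<open>Each slice of the product over a fixed \<open>x\<close> is an image of
    \<open>b\<close>. A second use of Replacement collects the slices into a set, whose union is the
    product.\<close>
  define S where "S x = the_set E (opair E x ` elts E b)" for x
  have S: "elts E (S x) = opair E x ` elts E b" for x
    unfolding S_def
    by (rule elts_the_set, rule replacement[where p = "fm_opair 1 2 0" and s = "\<lambda>_. x"]) simp
  have "\<exists>c. elts E c = S ` elts E a"
  proof (rule replacement)
    fix x y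
    have "y = S x \<longleftrightarrow> elts E y = opair E x ` elts E b"
      by (metis S extensional)
    also have "\<dots> \<longleftrightarrow> (\<forall>z. E z y \<longleftrightarrow> (\<exists>w. E w b \<and> z = opair E x w))"
      by (simp add: set_eq_iff image_iff elts_def Bex_def)
    finally show "sat E ((\<lambda>_. b)(0 := x, 1 := y))
        (FAll 3 (FIff (FMem 3 1) (FEx 4 (FAnd (FMem 4 2) (fm_opair 3 0 4))))) \<longleftrightarrow> y = S x"
      by auto
  qed
  then obtain c where c: "elts E c = S ` elts E a" ..
  obtain u where "elts E u = (\<Union>x \<in> elts E c. elts E x)"
    using union by blast
  then have "elts E u = {opair E x y | x y. E x a \<and> E y b}"
    by (simp add: c S) (auto simp: elts_def)
  then show ?thesis
    unfolding cart_def by (intro elts_the_set exI)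
qed

lemma mem_cart: "E z (cart E a b) \<longleftrightarrow> (\<exists>x y. z = opair E x y \<and> E x a \<and> E y b)"
  using elts_cart[of a b] by (auto simp: elts_def)

lemma opair_mem_cart [simp]: "E (opair E x y) (cart E a b) \<longleftrightarrow> E x a \<and> E y b"
  by (auto simp: mem_cart)

lemma sat_cart [simp]: "sat E s (fm_cart c a b) \<longleftrightarrow> s c = cart E (s a) (s b)"
proof -
  have "s c = cart E (s a) (s b) \<longleftrightarrow> elts E (s c) = elts E (cart E (s a) (s b))"
    by (auto intro: extensional)
  also have "\<dots> \<longleftrightarrow> (\<forall>z. E z (s c) \<longleftrightarrow> (\<exists>x y. E x (s a) \<and> E y (s b) \<and> z = opair E x y))"
    unfolding elts_cart by (auto simp: elts_def set_eq_iff)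
  finally show ?thesis
    by (simp add: fm_cart_def Let_def)
qed

text \<open>The functions form a set by Separation from the power set of the product: the first
  clause of \<open>is_fun\<close> is inclusion in the product, the second is the formula
  \<open>p\<close> below.\<close>

lemma mem_fun_space: "E f (fun_space E a b) \<longleftrightarrow> is_fun E f a b"
proof -
  \<comment> \<open>Variable 0 is \<open>f\<close> and variable 1 is \<open>a\<close>. Unique
    existence is written as one biconditional, with the value in variable 3.\<close>
  define p where "p = FAll 2 (FOr (FNeg (FMem 2 1)) (FEx 3 (FAll 4
    (FIff (FEx 5 (FAnd (fm_opair 5 2 4) (FMem 5 0))) (FEq 4 3)))))"
  have ex1: "(\<exists>!y. Q y) \<longleftrightarrow> (\<exists>z. \<forall>y. Q y \<longleftrightarrow> y = z)" for Q :: "'m \<Rightarrow> bool"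
    unfolding Ex1_def by auto
  have p: "sat E ((\<lambda>_. a)(0 := f)) p \<longleftrightarrow> (\<forall>x. E x a \<longrightarrow> (\<exists>!y. E (opair E x y) f))" for f
    unfolding p_def ex1 imp_conv_disj by simp
  obtain P where P: "elts E P = {x. elts E x \<subseteq> elts E (cart E a b)}"
    using power_set by blast
  have "E f P \<longleftrightarrow> f \<in> elts E P" for f
    by (simp add: elts_def)
  then have P': "E f P \<longleftrightarrow> (\<forall>z. E z f \<longrightarrow> (\<exists>x y. E x a \<and> E y b \<and> z = opair E x y))" for f
    unfolding P elts_cart by (auto simp: elts_def subset_eq)
  obtain c where c: "elts E c = {f. E f P \<and> sat E ((\<lambda>_. a)(0 := f)) p}"
    using separation by blast
  have "elts E c = {f. is_fun E f a b}"
    unfolding c P' p is_fun_def ..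
  then have "elts E (fun_space E a b) = {f. is_fun E f a b}"
    unfolding fun_space_def by (intro elts_the_set exI)
  then show ?thesis
    by (simp add: elts_def set_eq_iff)
qed

lemma is_fun_opair_iff:
  assumes "is_fun E f a b" and "E x a"
  shows "E (opair E x y) f \<longleftrightarrow> y = fapply E f x"
proof -
  have "\<exists>!y. E (opair E x y) f"
    using assms unfolding is_fun_def by blast
  then show ?thesis
    unfolding fapply_def by (metis the_equality)
qed

lemma is_fun_fapply: "is_fun E f a b \<Longrightarrow> E x a \<Longrightarrow> E (fapply E f x) b"
  using is_fun_opair_iff[of f a b x "fapply E f x"] unfolding is_fun_def by force

lemma is_fun_mem: "is_fun E f a b \<Longrightarrow> E z f \<longleftrightarrow> (\<exists>x. E x a \<and> z = opair E x (fapply E f x))"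
  using is_fun_opair_iff[of f a b] unfolding is_fun_def by metis

lemma is_fun_ext:
  assumes "is_fun E f a b" and "is_fun E g a b" and "\<And>x. E x a \<Longrightarrow> fapply E f x = fapply E g x"
  shows "f = g"
proof (rule extensional)
  show "elts E f = elts E g"
    using is_fun_mem[OF assms(1)] is_fun_mem[OF assms(2)] assms(3) by (auto simp: elts_def)
qed

text \<open>With \<open>c\<close> the set of stacks, this collects the pairs of a function and its
  gimel, the ground-model set behind the injection.\<close>

lemma ex_graph_set: "\<exists>J. elts E J = (\<lambda>f. opair E f (cart E f c)) ` elts E a"
  by (rule replacement[where s = "\<lambda>_. c" and p = "FEx 3 (FAnd (fm_cart 3 0 2) (fm_opair 1 0 3))"])
    auto

end


section \<open>Realizers\<close>

lemma finite_tvars: "finite (tvars t)"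
  by (induction t) auto

lemma eval_fresh: "n \<notin> tvars t \<Longrightarrow> eval (s(n := a)) t = eval s t"
proof (induction t)
  case (Fn F ts)
  have "eval (s(n := a)) u = eval s u" if "u \<in> set ts" for u
    by (rule Fn.IH) (use Fn.prems that in auto)
  then have "map (eval (s(n := a))) ts = map (eval s) ts"
    by simp
  then show ?case
    by (simp only: eval.simps)
qed auto

locale algebra_model = zf_model +
  fixes A :: "'m ralg"
  assumes ralg: "realizability_algebra E A"
begin

abbreviation lam :: "'m \<Rightarrow> bool" where "lam \<xi> \<equiv> E \<xi> (Lam A)"
abbreviation stk :: "'m \<Rightarrow> bool" where "stk \<pi> \<equiv> E \<pi> (Stk A)"
text \<open>A predicate, not an operation: it asserts that the process lies in the pole. Closure
  under anti-execution thereby takes the form of introduction rules.\<close>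

abbreviation pole :: "'m \<Rightarrow> 'm \<Rightarrow> bool" (infix \<open>\<^bold>\<star>\<close> 60)
  where "\<xi> \<^bold>\<star> \<pi> \<equiv> E (proc E A \<xi> \<pi>) (Pole A)"
abbreviation app_syn :: "'m \<Rightarrow> 'm \<Rightarrow> 'm" (infixl \<open>\<^bold>\<circ>\<close> 75)
  where "\<xi> \<^bold>\<circ> \<eta> \<equiv> ap E A \<xi> \<eta>"
abbreviation push_syn :: "'m \<Rightarrow> 'm \<Rightarrow> 'm" (infixr \<open>\<^bold>\<cdot>\<close> 70)
  where "\<xi> \<^bold>\<cdot> \<pi> \<equiv> push E A \<xi> \<pi>"
text \<open>Relative to one assignment, so that open subformulas can be treated;
  \<open>realizes\<close> quantifies over all assignments.\<close>

abbreviation forces :: "'m \<Rightarrow> (nat \<Rightarrow> 'm) \<Rightarrow> 'm frm \<Rightarrow> bool"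
  where "forces \<theta> s F \<equiv> \<theta> \<in> orth E A (falsity E A s F)"

lemmas ralg_conj = ralg[unfolded realizability_algebra_def]

lemma ralg_fun:
  "is_fun E (app_op A) (cart E (Lam A) (Lam A)) (Lam A)"
  "is_fun E (push_op A) (cart E (Lam A) (Stk A)) (Stk A)"
  "is_fun E (proc_op A) (cart E (Lam A) (Stk A)) (Prc A)"
  "is_fun E (cont_op A) (Stk A) (Lam A)"
  by (simp_all only: ralg_conj)

lemma lam_ap [simp, intro]: "lam \<xi> \<Longrightarrow> lam \<eta> \<Longrightarrow> lam (\<xi> \<^bold>\<circ> \<eta>)"
  unfolding ap_def by (rule is_fun_fapply[OF ralg_fun(1)]) simp

lemma stk_push [simp, intro]: "lam \<xi> \<Longrightarrow> stk \<pi> \<Longrightarrow> stk (\<xi> \<^bold>\<cdot> \<pi>)"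
  unfolding push_def by (rule is_fun_fapply[OF ralg_fun(2)]) simp

lemma prc_proc: "lam \<xi> \<Longrightarrow> stk \<pi> \<Longrightarrow> E (proc E A \<xi> \<pi>) (Prc A)"
  unfolding proc_def by (rule is_fun_fapply[OF ralg_fun(3)]) simp

lemma lam_cont [simp, intro]: "stk \<pi> \<Longrightarrow> lam (cont E A \<pi>)"
  unfolding cont_def by (rule is_fun_fapply[OF ralg_fun(4)])

lemma ralg_subset:
  "elts E (Pole A) \<subseteq> elts E (Prc A)"
  "elts E (QP A) \<subseteq> elts E (Lam A)"
  "{iB A, iC A, iI A, iK A, iW A, icc A} \<subseteq> elts E (QP A)"
  by (simp_all only: ralg_conj)

section \<open>The pole and anti-execution\<close>

lemma pole_Prc: "E p (Pole A) \<Longrightarrow> E p (Prc A)"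
  using ralg_subset(1) by (auto simp: elts_def)

lemma lam_QP: "E \<xi> (QP A) \<Longrightarrow> lam \<xi>"
  using ralg_subset(2) by (auto simp: elts_def)

lemma pole_exec: "exec E A p q \<Longrightarrow> E q (Pole A) \<Longrightarrow> E p (Pole A)"
  using ralg_conj by blast

lemma QP_ap [simp, intro]: "E \<xi> (QP A) \<Longrightarrow> E \<eta> (QP A) \<Longrightarrow> E (\<xi> \<^bold>\<circ> \<eta>) (QP A)"
  using ralg_conj by blast

lemma QP_instr [simp, intro]:
  "E (iB A) (QP A)" "E (iC A) (QP A)" "E (iI A) (QP A)" "E (iK A) (QP A)" "E (icc A) (QP A)"
  using ralg_subset(3) by (auto simp: elts_def)

lemmas lam_instr [simp, intro] = QP_instr[THEN lam_QP]

text \<open>A single step lies in every relation over which \<open>exec\<close> quantifies, hence in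
  \<open>exec\<close>, provided both ends are processes.\<close>

lemma pole_step:
  assumes step: "step E A p q" and q: "E q (Pole A)" and p: "E p (Prc A)"
  shows "E p (Pole A)"
proof (rule pole_exec[OF _ q])
  show "exec E A p q"
    unfolding exec_def using step p pole_Prc[OF q] by blast
qed

lemma pole_ap: "\<xi> \<^bold>\<star> \<eta> \<^bold>\<cdot> \<pi> \<Longrightarrow> lam \<xi> \<Longrightarrow> lam \<eta> \<Longrightarrow> stk \<pi> \<Longrightarrow> \<xi> \<^bold>\<circ> \<eta> \<^bold>\<star> \<pi>"
  by (rule pole_step[OF step.intros(1)]) (auto intro: prc_proc)

lemma pole_I: "\<xi> \<^bold>\<star> \<pi> \<Longrightarrow> lam \<xi> \<Longrightarrow> stk \<pi> \<Longrightarrow> iI A \<^bold>\<star> \<xi> \<^bold>\<cdot> \<pi>"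
  by (rule pole_step[OF step.intros(2)]) (auto intro: prc_proc)

lemma pole_K: "\<xi> \<^bold>\<star> \<pi> \<Longrightarrow> lam \<xi> \<Longrightarrow> lam \<eta> \<Longrightarrow> stk \<pi> \<Longrightarrow> iK A \<^bold>\<star> \<xi> \<^bold>\<cdot> \<eta> \<^bold>\<cdot> \<pi>"
  by (rule pole_step[OF step.intros(3)]) (auto intro: prc_proc)

lemma pole_C: "\<xi> \<^bold>\<star> \<zeta> \<^bold>\<cdot> \<eta> \<^bold>\<cdot> \<pi> \<Longrightarrow> lam \<xi> \<Longrightarrow> lam \<eta> \<Longrightarrow> lam \<zeta> \<Longrightarrow> stk \<pi> \<Longrightarrow>
    iC A \<^bold>\<star> \<xi> \<^bold>\<cdot> \<eta> \<^bold>\<cdot> \<zeta> \<^bold>\<cdot> \<pi>"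
  by (rule pole_step[OF step.intros(5)]) (auto intro: prc_proc)

lemma pole_B: "\<xi> \<^bold>\<star> (\<eta> \<^bold>\<circ> \<zeta>) \<^bold>\<cdot> \<pi> \<Longrightarrow> lam \<xi> \<Longrightarrow> lam \<eta> \<Longrightarrow> lam \<zeta> \<Longrightarrow> stk \<pi> \<Longrightarrow>
    iB A \<^bold>\<star> \<xi> \<^bold>\<cdot> \<eta> \<^bold>\<cdot> \<zeta> \<^bold>\<cdot> \<pi>"
  by (rule pole_step[OF step.intros(6)]) (auto intro: prc_proc)

lemma pole_cc: "\<xi> \<^bold>\<star> cont E A \<pi> \<^bold>\<cdot> \<pi> \<Longrightarrow> lam \<xi> \<Longrightarrow> stk \<pi> \<Longrightarrow> icc A \<^bold>\<star> \<xi> \<^bold>\<cdot> \<pi>"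
  by (rule pole_step[OF step.intros(7)]) (auto intro: prc_proc)

lemma pole_cont: "\<xi> \<^bold>\<star> \<pi> \<Longrightarrow> lam \<xi> \<Longrightarrow> stk \<pi> \<Longrightarrow> stk \<rho> \<Longrightarrow> cont E A \<pi> \<^bold>\<star> \<xi> \<^bold>\<cdot> \<rho>"
  by (rule pole_step[OF step.intros(8)]) (auto intro: prc_proc)

lemmas pole_intros = pole_ap pole_I pole_K pole_C pole_B pole_cc

lemma orthI: "lam \<xi> \<Longrightarrow> (\<And>\<pi>. \<pi> \<in> P \<Longrightarrow> \<xi> \<^bold>\<star> \<pi>) \<Longrightarrow> \<xi> \<in> orth E A P"
  by (simp add: orth_def)

lemma orthD: "\<xi> \<in> orth E A P \<Longrightarrow> \<pi> \<in> P \<Longrightarrow> \<xi> \<^bold>\<star> \<pi>"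
  by (simp add: orth_def)

lemma lam_orth: "\<xi> \<in> orth E A P \<Longrightarrow> lam \<xi>"
  by (simp add: orth_def)

lemma row_stk:
  assumes "table E A T N S" and "E a T" and "E b T"
  shows "\<rho> \<in> row E N a b \<Longrightarrow> stk \<rho>" and "\<rho> \<in> row E S a b \<Longrightarrow> stk \<rho>"
  using assms unfolding table_def by (fastforce dest: lam_orth)+

text \<open>Supplies the stack side conditions of the anti-execution rules. For the two recursively
  defined atoms, the table clauses show that every element is a push onto a stack.\<close>

lemma falsity_stk: "\<pi> \<in> falsity E A s F \<Longrightarrow> stk \<pi>"
proof (induction F arbitrary: s \<pi>)
  case (Imp F G)
  then show ?case
    by (auto dest: lam_orth)
qed (auto simp: elts_def notin_val_def subs_val_def dest: row_stk)


subsection \<open>Leibniz equality\<close>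

definition leib :: "'m \<Rightarrow> 'm \<Rightarrow> 'm set" where
  "leib a b = (\<Union>z. {\<xi> \<^bold>\<cdot> \<pi> | \<xi> \<pi>. \<xi> \<in> orth E A {\<pi>. stk \<pi> \<and> E (opair E a \<pi>) z} \<and>
                       stk \<pi> \<and> E (opair E b \<pi>) z})"

lemma falsity_Leibniz: "falsity E A s (t \<^bold>= u) = leib (eval s t) (eval s u)"
proof -
  define z where "z = (LEAST z. z \<notin> tvars t \<union> tvars u)"
  have "\<exists>z. z \<notin> tvars t \<union> tvars u"
    by (metis finite_Un finite_tvars ex_new_if_finite infinite_UNIV_nat)
  then have "z \<notin> tvars t \<union> tvars u"
    unfolding z_def by (rule LeastI_ex)
  then show ?thesis
    unfolding Leibniz_def Let_def z_def[symmetric] leib_def by (simp add: eval_fresh)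
qed

lemma leibI:
  assumes "lam \<xi>" and "stk \<pi>" and "E (opair E b \<pi>) z"
    and "\<And>\<pi>'. stk \<pi>' \<Longrightarrow> E (opair E a \<pi>') z \<Longrightarrow> \<xi> \<^bold>\<star> \<pi>'"
  shows "\<xi> \<^bold>\<cdot> \<pi> \<in> leib a b"
proof -
  have "\<xi> \<in> orth E A {\<pi>. stk \<pi> \<and> E (opair E a \<pi>) z}"
    using assms by (simp add: orth_def)
  with assms(2,3) show ?thesis
    unfolding leib_def by (intro UN_I[of z] CollectI exI conjI) simp_all
qed

lemma leibE:
  assumes "\<rho> \<in> leib a b"
  obtains \<xi> \<pi> where "\<rho> = \<xi> \<^bold>\<cdot> \<pi>" "lam \<xi>" "stk \<pi>" "a = b \<Longrightarrow> \<xi> \<^bold>\<star> \<pi>"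
  using assms unfolding leib_def orth_def by auto

lemma leib_refl: "leib a a = {\<xi> \<^bold>\<cdot> \<pi> | \<xi> \<pi>. lam \<xi> \<and> stk \<pi> \<and> \<xi> \<^bold>\<star> \<pi>}"
proof (intro equalityI subsetI)
  fix \<rho> assume "\<rho> \<in> leib a a"
  then show "\<rho> \<in> {\<xi> \<^bold>\<cdot> \<pi> | \<xi> \<pi>. lam \<xi> \<and> stk \<pi> \<and> \<xi> \<^bold>\<star> \<pi>}"
    by (rule leibE) blast
next
  fix \<rho> assume "\<rho> \<in> {\<xi> \<^bold>\<cdot> \<pi> | \<xi> \<pi>. lam \<xi> \<and> stk \<pi> \<and> \<xi> \<^bold>\<star> \<pi>}"
  then obtain \<xi> \<pi> where *: "\<rho> = \<xi> \<^bold>\<cdot> \<pi>" "lam \<xi>" "stk \<pi>" "\<xi> \<^bold>\<star> \<pi>"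
    by blast
  show "\<rho> \<in> leib a a"
    unfolding *(1)
    \<comment> \<open>The witness is the singleton of the pair (a, \<pi>), so that \<pi> is the only
      stack on which \<xi> is tested.\<close>
    by (rule leibI[where z = "upair E (opair E a \<pi>) (opair E a \<pi>)"])
      (use * in \<open>auto simp: mem_upair\<close>)
qed

lemma leib_distinct:
  assumes "a \<noteq> b"
  shows "leib a b = {\<xi> \<^bold>\<cdot> \<pi> | \<xi> \<pi>. lam \<xi> \<and> stk \<pi>}"
proof (intro equalityI subsetI)
  fix \<rho> assume "\<rho> \<in> leib a b"
  then show "\<rho> \<in> {\<xi> \<^bold>\<cdot> \<pi> | \<xi> \<pi>. lam \<xi> \<and> stk \<pi>}"
    by (rule leibE) blast
next
  fix \<rho> assume "\<rho> \<in> {\<xi> \<^bold>\<cdot> \<pi> | \<xi> \<pi>. lam \<xi> \<and> stk \<pi>}"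
  then obtain \<xi> \<pi> where *: "\<rho> = \<xi> \<^bold>\<cdot> \<pi>" "lam \<xi>" "stk \<pi>"
    by blast
  show "\<rho> \<in> leib a b"
    unfolding *(1)
    \<comment> \<open>The witness {b} \<times> \<Pi> contains no pair starting with
      \<open>a\<close>, so \<xi> is not tested at all, while every stack is available for
      \<open>b\<close>.\<close>
    by (rule leibI[where z = "cart E (upair E b b) (Stk A)"])
      (use * assms in \<open>auto simp: mem_upair\<close>)
qed

lemma forces_Leibniz: "eval s t = eval s u \<Longrightarrow> forces (iI A) s (t \<^bold>= u)"
  by (auto simp: falsity_Leibniz leib_refl intro!: orthI pole_I)


subsection \<open>Realizers for logical constructions\<close>

text \<open>The \<lambda>-term \<lambda>u. u \<theta>.\<close>

definition ex_real :: "'m \<Rightarrow> 'm" where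
  "ex_real \<theta> = iC A \<^bold>\<circ> iI A \<^bold>\<circ> \<theta>"

text \<open>The \<lambda>-term \<lambda>u. u \<theta> \<theta>', matching the encoding of
  conjunction as (F \<rightarrow> G \<rightarrow> \<bottom>) \<rightarrow> \<bottom>.\<close>

definition conj_real :: "'m \<Rightarrow> 'm \<Rightarrow> 'm" where
  "conj_real \<theta> \<theta>' = iC A \<^bold>\<circ> ex_real \<theta> \<^bold>\<circ> \<theta>'"

text \<open>The \<open>\<lambda>\<close>-term \<open>\<lambda>u. cc (\<lambda>k. u (k \<theta>))\<close>.\<close>

definition rel_real :: "'m \<Rightarrow> 'm" where
  "rel_real \<theta> = iB A \<^bold>\<circ> icc A \<^bold>\<circ> (iC A \<^bold>\<circ> (iB A \<^bold>\<circ> iC A \<^bold>\<circ> iB A) \<^bold>\<circ> \<theta>)"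

text \<open>The \<open>\<lambda>\<close>-term \<open>\<lambda>u v x. cc (\<lambda>k. u I (k x))\<close>.\<close>

definition sep_real :: "'m" where
  "sep_real = iB A \<^bold>\<circ> iK A \<^bold>\<circ> (iB A \<^bold>\<circ> (iB A \<^bold>\<circ> icc A) \<^bold>\<circ>
     (iB A \<^bold>\<circ> iC A \<^bold>\<circ> (iB A \<^bold>\<circ> iB A \<^bold>\<circ> (iC A \<^bold>\<circ> iI A \<^bold>\<circ> iI A))))"

lemma lam_real [simp, intro]:
  "lam \<theta> \<Longrightarrow> lam (ex_real \<theta>)"
  "lam \<theta> \<Longrightarrow> lam \<theta>' \<Longrightarrow> lam (conj_real \<theta> \<theta>')"
  "lam \<theta> \<Longrightarrow> lam (rel_real \<theta>)"
  "lam sep_real"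
  unfolding ex_real_def conj_real_def rel_real_def sep_real_def by auto

lemma QP_real [simp, intro]:
  "E \<theta> (QP A) \<Longrightarrow> E (ex_real \<theta>) (QP A)"
  "E \<theta> (QP A) \<Longrightarrow> E \<theta>' (QP A) \<Longrightarrow> E (conj_real \<theta> \<theta>') (QP A)"
  "E \<theta> (QP A) \<Longrightarrow> E (rel_real \<theta>) (QP A)"
  "E sep_real (QP A)"
  unfolding ex_real_def conj_real_def rel_real_def sep_real_def by auto

lemma pole_ex_real: "\<xi> \<^bold>\<star> \<theta> \<^bold>\<cdot> \<pi> \<Longrightarrow> lam \<theta> \<Longrightarrow> lam \<xi> \<Longrightarrow> stk \<pi> \<Longrightarrow> ex_real \<theta> \<^bold>\<star> \<xi> \<^bold>\<cdot> \<pi>"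
  unfolding ex_real_def by (intro pole_intros) auto

lemma pole_conj_real:
  "\<xi> \<^bold>\<star> \<theta> \<^bold>\<cdot> \<theta>' \<^bold>\<cdot> \<pi> \<Longrightarrow> lam \<theta> \<Longrightarrow> lam \<theta>' \<Longrightarrow> lam \<xi> \<Longrightarrow> stk \<pi> \<Longrightarrow> conj_real \<theta> \<theta>' \<^bold>\<star> \<xi> \<^bold>\<cdot> \<pi>"
  unfolding conj_real_def by (intro pole_intros pole_ex_real) auto

lemma pole_rel_real:
  "\<xi> \<^bold>\<star> (cont E A \<pi> \<^bold>\<circ> \<theta>) \<^bold>\<cdot> \<pi> \<Longrightarrow> lam \<theta> \<Longrightarrow> lam \<xi> \<Longrightarrow> stk \<pi> \<Longrightarrow> rel_real \<theta> \<^bold>\<star> \<xi> \<^bold>\<cdot> \<pi>"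
  unfolding rel_real_def by (intro pole_intros) auto

lemma pole_sep_real:
  "u \<^bold>\<star> iI A \<^bold>\<cdot> (cont E A \<pi> \<^bold>\<circ> \<xi>) \<^bold>\<cdot> \<pi> \<Longrightarrow> lam u \<Longrightarrow> lam v \<Longrightarrow> lam \<xi> \<Longrightarrow> stk \<pi> \<Longrightarrow>
    sep_real \<^bold>\<star> u \<^bold>\<cdot> v \<^bold>\<cdot> \<xi> \<^bold>\<cdot> \<pi>"
  unfolding sep_real_def by (intro pole_intros) auto

text \<open>Whatever stack it meets, the continuation discards it and resumes \<xi> on \<pi>, where
  the process is in the pole.\<close>

lemma cont_ap_forces_bot:
  "\<xi> \<^bold>\<star> \<pi> \<Longrightarrow> lam \<xi> \<Longrightarrow> stk \<pi> \<Longrightarrow> cont E A \<pi> \<^bold>\<circ> \<xi> \<in> orth E A (elts E (Stk A))"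
  by (auto intro!: orthI pole_ap pole_cont simp: elts_def)

section \<open>Introduction rules for realizers of compound formulas\<close>

lemma forces_Forall: "(\<And>a. forces \<theta> (s(n := a)) F) \<Longrightarrow> forces \<theta> s (Forall n F)"
  by (auto simp: orth_def)

lemma falsity_ImpI:
  "forces \<xi> s F \<Longrightarrow> \<pi> \<in> falsity E A s G \<Longrightarrow> \<xi> \<^bold>\<cdot> \<pi> \<in> falsity E A s (F \<^bold>\<rightarrow> G)"
  unfolding falsity.simps by blast

lemma falsity_NotI: "forces \<xi> s F \<Longrightarrow> stk \<pi> \<Longrightarrow> \<xi> \<^bold>\<cdot> \<pi> \<in> falsity E A s (Not_f F)"
  by (rule falsity_ImpI) (simp_all add: elts_def)

lemma forces_ImpI:
  assumes "lam \<theta>"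
    and "\<And>\<xi> \<pi>. forces \<xi> s F \<Longrightarrow> lam \<xi> \<Longrightarrow> \<pi> \<in> falsity E A s G \<Longrightarrow> stk \<pi> \<Longrightarrow> \<theta> \<^bold>\<star> \<xi> \<^bold>\<cdot> \<pi>"
  shows "forces \<theta> s (F \<^bold>\<rightarrow> G)"
proof (rule orthI[OF assms(1)])
  fix \<rho> assume "\<rho> \<in> falsity E A s (F \<^bold>\<rightarrow> G)"
  then obtain \<xi> \<pi> where "\<rho> = \<xi> \<^bold>\<cdot> \<pi>" "forces \<xi> s F" "\<pi> \<in> falsity E A s G"
    unfolding falsity.simps by blast
  then show "\<theta> \<^bold>\<star> \<rho>"
    using assms(2)[of \<xi> \<pi>] lam_orth[of \<xi>] falsity_stk[of \<pi> s G] by simp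
qed

text \<open>Existence is encoded as \<not>\<forall>\<not>, so it suffices to hand \<theta> to the
  opponent. The witness \<open>a\<close> occurs only in the assignment and leaves no trace in the
  term.\<close>

lemma forces_Ex:
  assumes "forces \<theta> (s(n := a)) F"
  shows "forces (ex_real \<theta>) s (Ex_f n F)"
proof (rule forces_ImpI)
  fix \<xi> \<pi>
  assume \<xi>: "forces \<xi> s (Forall n (Not_f F))" "lam \<xi>" and \<pi>: "stk \<pi>"
  have "\<theta> \<^bold>\<cdot> \<pi> \<in> falsity E A s (Forall n (Not_f F))"
    unfolding falsity.simps(7) using falsity_NotI[OF assms \<pi>] by (rule UN_I[OF UNIV_I])
  then show "ex_real \<theta> \<^bold>\<star> \<xi> \<^bold>\<cdot> \<pi>"
    by (intro pole_ex_real orthD[OF \<xi>(1)] \<xi>(2) \<pi> lam_orth[OF assms])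
qed (intro lam_real lam_orth[OF assms])

lemma forces_Conj:
  assumes "forces \<theta> s F" and "forces \<theta>' s G"
  shows "forces (conj_real \<theta> \<theta>') s (F \<^bold>\<and> G)"
proof (rule forces_ImpI)
  fix \<xi> \<pi>
  assume \<xi>: "forces \<xi> s (F \<^bold>\<rightarrow> G \<^bold>\<rightarrow> FBot)" "lam \<xi>" and \<pi>: "stk \<pi>"
  then show "conj_real \<theta> \<theta>' \<^bold>\<star> \<xi> \<^bold>\<cdot> \<pi>"
    by (intro pole_conj_real orthD[OF \<xi>(1)] falsity_ImpI falsity_NotI assms lam_orth[OF assms(1)]
        lam_orth[OF assms(2)])
qed (intro lam_real lam_orth[OF assms(1)] lam_orth[OF assms(2)])

text \<open>A gimel pairs each of its members with all stacks, so this truth value is all or nothing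
  and the ground model decides which.\<close>

lemma falsity_NotEps_gimel:
  "eval s u = gimel E A X \<Longrightarrow>
    falsity E A s (NotEps t u) = (if E (eval s t) X then elts E (Stk A) else {})"
  by (auto simp: gimel_def elts_def)

lemma forces_Eps:
  assumes "eval s u = gimel E A X" and "E (eval s t) X"
  shows "forces (iI A) s (t \<^bold>\<in> u)"
proof (rule forces_ImpI)
  fix \<xi> \<pi>
  assume \<xi>: "forces \<xi> s (NotEps t u)" "lam \<xi>" and \<pi>: "stk \<pi>"
  have "\<pi> \<in> falsity E A s (NotEps t u)"
    unfolding falsity_NotEps_gimel[OF assms(1)] using assms(2) \<pi> by (simp add: elts_def)
  then show "iI A \<^bold>\<star> \<xi> \<^bold>\<cdot> \<pi>"
    by (intro pole_I orthD[OF \<xi>(1)] \<xi>(2) \<pi>)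
qed simp

text \<open>
  If \<open>t\<close> is not in \<open>X\<close>, the premise is realized by \<open>\<xi>\<close> only if \<open>\<xi>\<close> realizes \<open>\<top> \<rightarrow> \<bottom>\<close>, so that any
  argument will do.
\<close>

lemma forces_Eps_Imp:
  assumes "eval s u = gimel E A X" and "E (eval s t) X \<Longrightarrow> forces \<theta> s F" and "lam \<theta>"
  shows "forces (rel_real \<theta>) s (t \<^bold>\<in> u \<^bold>\<rightarrow> F)"
proof (rule forces_ImpI)
  fix \<xi> \<pi>
  assume \<xi>: "forces \<xi> s (t \<^bold>\<in> u)" "lam \<xi>" and \<pi>: "\<pi> \<in> falsity E A s F" "stk \<pi>"
  have "forces (cont E A \<pi> \<^bold>\<circ> \<theta>) s (NotEps t u)"
  proof (cases "E (eval s t) X")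
    \<comment> \<open>Here the argument must realize \<bottom>; it does, because it restores \<pi>,
      a stack in the truth value of \<open>F\<close> that \<theta> realizes.\<close>
    case True
    then show ?thesis
      unfolding falsity_NotEps_gimel[OF assms(1)]
      using assms(2,3) \<pi> by (simp add: cont_ap_forces_bot orthD)
  next
    case False
    then show ?thesis
      unfolding falsity_NotEps_gimel[OF assms(1)] using assms(3) \<pi> by (simp add: orth_def)
  qed
  then show "rel_real \<theta> \<^bold>\<star> \<xi> \<^bold>\<cdot> \<pi>"
    by (intro pole_rel_real orthD[OF \<xi>(1)] falsity_NotI \<pi>(2) \<xi>(2) assms(3))
qed (intro lam_real assms(3))


subsection \<open>Evaluation of functions\<close>

lemma leib_fun:
  assumes "is_fun E f X Y" and "is_fun E g X Y" and "elts E X \<noteq> {}"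
  shows "\<exists>x. E x X \<and> leib (fapply E f x) (fapply E g x) = leib f g"
proof (cases "f = g")
  case True
  \<comment> \<open>Between equal individuals \<open>leib\<close> does not depend on the individual,
    so any element of the nonempty \<open>X\<close> serves.\<close>
  then show ?thesis
    using assms(3) by (auto simp: leib_refl elts_def)
next
  case False
  then obtain x where "E x X" "fapply E f x \<noteq> fapply E g x"
    using is_fun_ext[OF assms(1,2)] by blast
  \<comment> \<open>Between distinct individuals \<open>leib\<close> contains all pushes of terms
    onto stacks, whichever pair is compared.\<close>
  then have "E x X \<and> leib (fapply E f x) (fapply E g x) = leib f g"
    using False by (simp add: leib_distinct)
  then show ?thesis ..
qed

lemma forces_ext:
  assumes X: "elts E X \<noteq> {}"
    and app: "\<And>f x. E f (fun_space E X Y) \<Longrightarrow> E x X \<Longrightarrow> app [f, x] = fapply E f x"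
  shows "forces (iI A) s
    (ForallG (fun_space E X Y) 0 (ForallG (fun_space E X Y) 1
      (ForallG X 2 (Fn app [Var 0, Var 2] \<^bold>= Fn app [Var 1, Var 2]) \<^bold>\<rightarrow> Var 0 \<^bold>= Var 1)))"
proof (rule orthI, goal_cases)
  case (2 \<rho>)
  then obtain f g \<xi> \<pi> where \<rho>: "\<rho> = \<xi> \<^bold>\<cdot> \<pi>"
    and fg: "E f (fun_space E X Y)" "E g (fun_space E X Y)"
    and \<xi>: "\<xi> \<in> orth E A (\<Union>x \<in> elts E X. leib (app [f, x]) (app [g, x]))"
    and \<pi>: "\<pi> \<in> leib f g"
    by (auto simp: falsity_Leibniz elts_def)
  obtain x where "E x X" "leib (app [f, x]) (app [g, x]) = leib f g"
    using leib_fun[OF _ _ X] fg by (metis app mem_fun_space)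
  \<comment> \<open>The premise has as truth value the union over \<open>X\<close>, which includes
    the set for this \<open>x\<close>; as that set is \<open>leib f g\<close>, it contains
    \<pi>.\<close>
  then have "\<xi> \<^bold>\<star> \<pi>"
    using \<xi> \<pi> by (auto simp: elts_def intro: orthD)
  moreover have "stk \<pi>"
    using \<pi> by (auto simp: leib_def dest: lam_orth)
  ultimately show ?case
    unfolding \<rho> using \<xi> by (auto intro: pole_I dest: lam_orth)
qed auto

section \<open>The injection in the realizability model\<close>

text \<open>Follows the shape of \<open>function_frm\<close>: \<open>rel_real\<close> for each
  membership premise, \<open>ex_real\<close> for each existential, \<open>iI\<close> at the leaves.
  It is the same for all functions, hence usable below a quantifier over them.\<close>

definition fun_real :: "'m" where
  "fun_real = conj_real (rel_real (ex_real (ex_real (conj_real (iI A) (conj_real (iI A) (iI A))))))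
     (conj_real (rel_real (ex_real (iI A))) (rel_real (rel_real (iI A))))"

text \<open>
  In the realizability model the graph of \<open>f\<close> is the gimel of the graph of \<open>f\<close> in the ground model.
\<close>

lemma forces_function:
  assumes f: "is_fun E f X Y" and g: "s g = gimel E A f"
  shows "forces fun_real s (function_frm E g (gimel E A X) (gimel E A Y))"
  unfolding function_frm_def Let_def fun_real_def
proof (intro forces_Conj forces_Forall forces_Eps_Imp[where u = "Var g" and X = f]
    forces_Eps_Imp[where u = "Cst (gimel E A X)" and X = X], goal_cases)
  \<comment> \<open>Each use of \<open>forces_Eps_Imp\<close> leaves three goals. The named cases
    treat what remains of the middle one; the others are side conditions closed at the end.\<close>
  case (2 z)
  then obtain x where x: "E x X" "z = opair E x (fapply E f x)"
    using is_fun_mem[OF f] by auto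
  show ?case
    by (rule forces_Ex[where a = x], rule forces_Ex[where a = "fapply E f x"],
        intro forces_Conj forces_Eps forces_Leibniz)
      (use x is_fun_fapply[OF f] in \<open>auto simp: Pair_t_def\<close>)
next
  case (5 x)
  then show ?case
    by (intro forces_Ex[where a = "fapply E f x"] forces_Eps[where X = f])
      (auto simp: Pair_t_def g is_fun_opair_iff[OF f])
next
  case (9 x y y')
  then have "E (opair E x y) f" "E (opair E x y') f"
    by (auto simp: Pair_t_def)
  then have "y = y'"
    using is_fun_mem[OF f] by auto
  then show ?case
    by (intro forces_Leibniz) simp
qed (auto simp: g)

text \<open>Two functions with the same domain are equal as soon as one graph includes the other, so
  a single inclusion is tested, at a well-chosen element. \<open>F\<close> takes the place of the
  converse inclusion.\<close>

lemma forces_separation: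
  assumes f: "is_fun E f X Y" and f': "is_fun E f' X Y" and X: "elts E X \<noteq> {}"
    and s: "s m = f" "s n = f'" "s g = gimel E A f" "s g' = gimel E A f'"
    and z: "z \<noteq> g" "z \<noteq> g'"
  shows "forces sep_real s
    (Forall z (Var z \<^bold>\<in> Var g \<^bold>\<rightarrow> Var z \<^bold>\<in> Var g') \<^bold>\<rightarrow> F \<^bold>\<rightarrow> Var m \<^bold>= Var n)"
proof (rule orthI, goal_cases)
  case (2 \<rho>)
  let ?P = "Var z \<^bold>\<in> Var g \<^bold>\<rightarrow> Var z \<^bold>\<in> Var g'"
  obtain u v \<sigma> where \<rho>: "\<rho> = u \<^bold>\<cdot> v \<^bold>\<cdot> \<sigma>"
    and u: "forces u s (Forall z ?P)" and v: "lam v" and \<sigma>: "\<sigma> \<in> leib f f'"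
    using 2 by (auto simp: falsity_Leibniz s simp del: falsity.simps(3,7) dest: lam_orth)
  \<comment> \<open>Both forms of \<open>leib\<close> consist of pushes; membership of the process
    in the pole is known only when the functions agree.\<close>
  obtain \<xi> \<pi> where \<sigma>_eq: "\<sigma> = \<xi> \<^bold>\<cdot> \<pi>" and \<xi>: "lam \<xi>" and \<pi>: "stk \<pi>"
    and pole: "f = f' \<Longrightarrow> \<xi> \<^bold>\<star> \<pi>"
    using \<sigma> by (cases "f = f'") (auto simp: leib_refl leib_distinct)
  \<comment> \<open>If the functions differ, a pair of \<open>f\<close> missing from
    \<open>f'\<close> is taken; otherwise any pair of \<open>f\<close>, which exists because
    \<open>X\<close> is nonempty.\<close>
  have "\<exists>a. E a f \<and> (f = f' \<or> \<not> E a f')"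
  proof (cases "f = f'")
    case True
    then show ?thesis
      using X is_fun_mem[OF f] by (auto simp: elts_def)
  next
    case False
    then obtain x where "E x X" "fapply E f x \<noteq> fapply E f' x"
      using is_fun_ext[OF f f'] by blast
    then have "E (opair E x (fapply E f x)) f" "\<not> E (opair E x (fapply E f x)) f'"
      by (auto simp: is_fun_opair_iff[OF f] is_fun_opair_iff[OF f'])
    then show ?thesis
      by blast
  qed
  then obtain a where a: "E a f" "f = f' \<or> \<not> E a f'"
    by blast
  let ?s = "s(z := a)"
  have I: "forces (iI A) ?s (Var z \<^bold>\<in> Var g)"
    by (rule forces_Eps[where X = f]) (use z s a in auto)
  \<comment> \<open>For equal functions this term must realize \<bottom>, which it does by resuming
    \<xi> on \<pi>. For distinct ones the truth value of the atom is empty, so any term realizes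
    it.\<close>
  have "forces (cont E A \<pi> \<^bold>\<circ> \<xi>) ?s (NotEps (Var z) (Var g'))"
  proof (cases "f = f'")
    case True
    then show ?thesis
      using falsity_NotEps_gimel[of ?s "Var g'" f "Var z"] z s a pole \<xi> \<pi>
      by (simp add: cont_ap_forces_bot del: falsity.simps(3))
  next
    case False
    then show ?thesis
      using falsity_NotEps_gimel[of ?s "Var g'" f' "Var z"] z s a \<xi> \<pi>
      by (auto simp: orth_def simp del: falsity.simps(3))
  qed
  then have "iI A \<^bold>\<cdot> (cont E A \<pi> \<^bold>\<circ> \<xi>) \<^bold>\<cdot> \<pi> \<in> falsity E A ?s ?P"
    using I \<pi> by (auto simp: elts_def simp del: falsity.simps(3))
  then have "u \<^bold>\<star> iI A \<^bold>\<cdot> (cont E A \<pi> \<^bold>\<circ> \<xi>) \<^bold>\<cdot> \<pi>"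
    by (intro orthD[OF u]) (auto simp del: falsity.simps(3,6))
  then show ?case
    unfolding \<rho> \<sigma>_eq by (rule pole_sep_real) (use u v \<xi> \<pi> in \<open>auto dest: lam_orth\<close>)
qed auto

lemma realized_injection:
  assumes X: "elts E X \<noteq> {}"
    and app: "\<And>f x. E f (fun_space E X Y) \<Longrightarrow> E x X \<Longrightarrow> app [f, x] = fapply E f x"
  shows "realized E A
    (injection_frm E app (gimel E A (fun_space E X Y)) (gimel E A X) (gimel E A Y))"
proof -
  obtain J where "elts E J = (\<lambda>f. opair E f (gimel E A f)) ` elts E (fun_space E X Y)"
    using ex_graph_set unfolding gimel_def by blast
  then have J: "E z J \<longleftrightarrow> (\<exists>f. is_fun E f X Y \<and> z = opair E f (gimel E A f))" for z
    by (auto simp: elts_def set_eq_iff image_iff mem_fun_space)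
  have app': "app [f, x] = fapply E f x" if "is_fun E f X Y" "E x X" for f x
    using that by (simp add: app mem_fun_space)
  \<comment> \<open>The five conjuncts follow those of \<open>injection_frm\<close>: shape of the
    elements, totality, single-valuedness, injectivity, and values given by
    \<open>app\<close>.\<close>
  define \<theta> where "\<theta> = ex_real
    (conj_real (rel_real (ex_real (ex_real (conj_real (iI A) (conj_real fun_real (iI A))))))
    (conj_real (rel_real (ex_real (iI A)))
    (conj_real (rel_real (rel_real (iI A)))
    (conj_real (rel_real (rel_real sep_real))
      (rel_real (rel_real (iI A)))))))"
  have "E \<theta> (QP A)"
    unfolding \<theta>_def fun_real_def by auto
  moreover have "forces \<theta> s
    (injection_frm E app (gimel E A (fun_space E X Y)) (gimel E A X) (gimel E A Y))" for s
    unfolding injection_frm_def Let_def \<theta>_def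
  \<comment> \<open>The injection itself is witnessed by the gimel of \<open>J\<close>, so that
    \<open>J\<close> decides which pairs belong to it.\<close>
  proof (rule forces_Ex[where a = "gimel E A J"],
      intro forces_Conj forces_Forall forces_Eps_Imp[where u = "Var 0" and X = J]
        forces_Eps_Imp[where u = "Cst (gimel E A X)" and X = X]
        forces_Eps_Imp[where u = "Cst (gimel E A (fun_space E X Y))" and X = "fun_space E X Y"],
      goal_cases)
    case (2 z)
    then obtain f where f: "is_fun E f X Y" "z = opair E f (gimel E A f)"
      using J by auto
    show ?case
      by (rule forces_Ex[where a = f], rule forces_Ex[where a = "gimel E A f"],
          intro forces_Conj forces_Eps forces_Leibniz forces_function)
        (use f in \<open>auto simp: Pair_t_def mem_fun_space\<close>)
  next
    case (5 f)
    then show ?case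
      by (intro forces_Ex[where a = "gimel E A f"] forces_Eps[where X = J])
        (auto simp: Pair_t_def J mem_fun_space)
  next
    case (9 f g g')
    then have "g = g'"
      by (auto simp: Pair_t_def J)
    then show ?case
      by (intro forces_Leibniz) simp
  next
    \<comment> \<open>The quantifiers range over all individuals; the two memberships in
      \<open>J\<close> are what turns \<open>f\<close> and \<open>f'\<close> into functions and
      \<open>g\<close> and \<open>g'\<close> into their gimels.\<close>
    case (14 f f' g g')
    then have "is_fun E f X Y" "is_fun E f' X Y" "g = gimel E A f" "g' = gimel E A f'"
      by (auto simp: Pair_t_def J)
    then show ?case
      by (intro forces_separation[OF _ _ X]) auto
  next
    \<comment> \<open>Since \<open>app [f, x]\<close> is the value of \<open>f\<close> at
      \<open>x\<close>, the pair in question belongs to the ground-model graph \<open>f\<close>,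
      whose gimel is \<open>g\<close>.\<close>
    case (19 f g x)
    then have "is_fun E f X Y" "g = gimel E A f" "E x X"
      by (auto simp: Pair_t_def J)
    then show ?case
      by (intro forces_Eps[where X = f]) (auto simp: Pair_t_def app' is_fun_opair_iff)
  qed (auto simp: fun_real_def)
  ultimately show ?thesis
    unfolding realized_def realizes_def by blast
qed

end

theorem theorem16:
  fixes E :: "'m \<Rightarrow> 'm \<Rightarrow> bool" and A :: "'m ralg"
    and X Y :: 'm and app :: "'m list \<Rightarrow> 'm"
  assumes "ZF_VL E"
    and "realizability_algebra E A"
    and "coherent E A"
    and "elts E X \<noteq> {}"
    and "functional E 2 app"
    and "\<And>f x. E f (fun_space E X Y) \<Longrightarrow> E x X \<Longrightarrow> app [f, x] = fapply E f x"
  shows "realizes E A (iI A)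
           (ForallG (fun_space E X Y) 0 (ForallG (fun_space E X Y) 1
             (ForallG X 2 (Fn app [Var 0, Var 2] \<^bold>= Fn app [Var 1, Var 2])
               \<^bold>\<rightarrow> Var 0 \<^bold>= Var 1)))
       \<and> realized E A
           (injection_frm E app
             (gimel E A (fun_space E X Y)) (gimel E A X) (gimel E A Y))"
proof -
  interpret algebra_model E A
    using assms(1,2) by unfold_locales (auto simp: ZF_VL_def)
  show ?thesis
    unfolding realizes_def
    using forces_ext[OF assms(4,6)] realized_injection[OF assms(4,6)] by blast
qed

end
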